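(* Let $X$ be a real $m\times n$ matrix with non-negative entries, and let $\|{}_iX\|_1=\sum_j |X_{(i,j)}|$ denote the $1$-norm of its $i$-th row. Then $$\|X\|_{cbF}=\|X\|_F=\Big(\sum_{i=1}^m \|{}_iX\|_1^2\Big)^{1/2},$$ and, if $X\neq 0$, Haagerup's vector of $X$ is the optimal positive unit vector $\xi$ of the cbF-factorization of $X$.
   Context: Notation: for $v\in\mathbb C^n$, $\Delta_n(v)$ is the diagonal $n\times n$ matrix with diagonal $v$; $\Omega=(1,\dots,1)\in\mathbb C^n$; $\|\cdot\|_\infty$ on matrices is the operator norm (with respect to Euclidean norms). "Positive" for a vector means having non-negative entries. For a complex $m\times n$ matrix $X$, $\|X\|_F$ is the norm of the linear operator $F_X:(\mathbb C^n,\|\cdot\|_\infty)\to(\mathbb C^m,\|\cdot\|_2)$, $F_X(z)=Xz$, where $\|z\|_\infty=\max_j|z_j|$. $\|X\|_{cbF}$ is the completely bounded norm of $F_X$ (with $\mathbb C^n$ the abelian C*-algebra of functions on $n$ points and $\mathbb C^m$ the column Hilbert space); concretely $$\|X\|_{cbF}=\min\{\|B\|_\infty : X=B\Delta_n(\xi),\ B\in M_{(m,n)}(\mathbb C),\ \xi\in\mathbb R^n,\ \xi_j\ge 0,\ \|\xi\|_2=1\}.$$ A cbF-factorization of $X$ is a factorization $X=B\Delta_n(\xi)$ with $\xi$ a unit vector with non-negative entries and $\|B\|_\infty=\|X\|_{cbF}$; the vector $\xi$ is then called the optimal positive unit vector of the cbF-factorization. Haagerup's vector of a non-zero complex $m\times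 n$ matrix $X$: choose $u\in\mathbb C^n$ with $|u_j|=1$ for all $j$ and $\|X\Delta_n(u)\Omega\|_2=\|X\|_F$. Put $\lambda=\|X\|_F^{-2}\,\Delta_n(u)^*X^*X\Delta_n(u)\Omega$. Then $\lambda$ has non-negative entries with sum $1$, and Haagerup's vector is the unit vector $\xi$ with $\xi_j=\sqrt{\lambda_j}$. For $X$ with non-negative entries one may take $u=\Omega$. *)

theory Defs
  imports "HOL-Analysis.Analysis"
begin

text \<open>Complex \<open>m \<times> n\<close> matrices have type \<^typ>\<open>complex^'n^'m\<close>; the norm on \<^typ>\<open>complex^'n\<close> is the
  Euclidean one, so \<open>onorm ((*v) B)\<close> is the operator norm of \<open>B\<close>.\<close>

definition diag_mat :: "complex^'n \<Rightarrow> complex^'n^'n" where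
  "diag_mat v = (\<chi> i j. if i = j then v $ i else 0)"

definition conj_transpose :: "complex^'n^'m \<Rightarrow> complex^'m^'n" where
  "conj_transpose A = (\<chi> i j. cnj (A $ j $ i))"

definition complex_vec :: "real^'n \<Rightarrow> complex^'n" where
  "complex_vec \<xi> = (\<chi> j. complex_of_real (\<xi> $ j))"

definition mat_opnorm :: "complex^'n^'m \<Rightarrow> real" where
  "mat_opnorm B = onorm ((*v) B)"

text \<open>The library's \<^const>\<open>infnorm\<close> is not used here, because on \<^typ>\<open>complex^'n\<close> it takes real and
  imaginary parts separately.\<close>

definition max_norm :: "complex^'n \<Rightarrow> real" where
  "max_norm z = Max (range (\<lambda>j. cmod (z $ j)))"

definition F_norm :: "complex^'n^'m \<Rightarrow> real" where
  "F_norm X = (SUP z\<in>{z. max_norm z \<le> 1}. norm (X *v z))"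

text \<open>Since \<open>k\<close> ranges over all natural numbers in the definition of the completely bounded norm,
  \<open>k \<times> k\<close> arrays are functions on index sets here. \<open>index_opnorm R S a\<close> is the norm of the
  operator from \<open>\<ell>\<^sup>2(S)\<close> to \<open>\<ell>\<^sup>2(R)\<close> with matrix \<open>a\<close>.\<close>

definition index_opnorm :: "'r set \<Rightarrow> 's set \<Rightarrow> ('r \<Rightarrow> 's \<Rightarrow> complex) \<Rightarrow> real" where
  "index_opnorm R S a =
     (SUP v\<in>{v. L2_set (\<lambda>s. cmod (v s)) S \<le> 1}. L2_set (\<lambda>r. cmod (\<Sum>s\<in>S. a r s * v s)) R)"

text \<open>\<open>M\<^sub>k(\<complex>\<^sup>n)\<close> for the abelian C*-algebra \<open>\<complex>\<^sup>n\<close> is the C*-algebra of \<open>n\<close>-tuples of \<open>k \<times> k\<close> matrices.\<close>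

definition abelian_matrix_norm :: "nat \<Rightarrow> (nat \<Rightarrow> nat \<Rightarrow> complex^'n) \<Rightarrow> real" where
  "abelian_matrix_norm k a = Max (range (\<lambda>j. index_opnorm {..<k} {..<k} (\<lambda>r s. a r s $ j)))"

text \<open>The column Hilbert space \<open>\<complex>\<^sup>m\<close> is the space of \<open>m \<times> 1\<close> matrices, so the norm of \<open>M\<^sub>k(\<complex>\<^sup>m)\<close> is
  the operator norm of the \<open>mk \<times> k\<close> matrix obtained by replacing each entry by its column.\<close>

definition column_matrix_norm :: "nat \<Rightarrow> (nat \<Rightarrow> nat \<Rightarrow> complex^'m) \<Rightarrow> real" where
  "column_matrix_norm k b = index_opnorm (UNIV \<times> {..<k}) {..<k} (\<lambda>(i, r) s. b r s $ i)"

text \<open>The supremum over all \<open>k\<close> of the norms of the amplifications \<open>M\<^sub>k(\<complex>\<^sup>n) \<rightarrow> M\<^sub>k(\<complex>\<^sup>m)\<close> of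
  \<open>z \<mapsto> X z\<close>; the term \<open>k = 0\<close> contributes only the value \<open>0\<close>.\<close>

definition cbF_norm :: "complex^'n^'m \<Rightarrow> real" where
  "cbF_norm X = (SUP (k, a)\<in>{(k, a). abelian_matrix_norm k a \<le> 1}.
                   column_matrix_norm k (\<lambda>r s. X *v a r s))"

definition cbF_factorization :: "complex^'n^'m \<Rightarrow> complex^'n^'m \<Rightarrow> real^'n \<Rightarrow> bool" where
  "cbF_factorization X B \<xi> \<longleftrightarrow>
     X = B ** diag_mat (complex_vec \<xi>) \<and> (\<forall>j. 0 \<le> \<xi> $ j) \<and> norm \<xi> = 1 \<and>
     mat_opnorm B = cbF_norm X"

definition optimal_positive_unit_vector :: "complex^'n^'m \<Rightarrow> real^'n \<Rightarrow> bool" where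
  "optimal_positive_unit_vector X \<xi> \<longleftrightarrow> (\<exists>B. cbF_factorization X B \<xi>)"

text \<open>The vector \<open>1\<close> is the componentwise one, i.e. \<open>\<Omega> = (1, \<dots>, 1)\<close>.\<close>

definition haagerup_lambda :: "complex^'n^'m \<Rightarrow> complex^'n \<Rightarrow> complex^'n" where
  "haagerup_lambda X u = (1 / (F_norm X)\<^sup>2) *\<^sub>R
     ((conj_transpose (diag_mat u) ** conj_transpose X ** X ** diag_mat u) *v 1)"

text \<open>Haagerup's vector is introduced as a relation because of the choice of \<open>u\<close>. The last condition says
  that \<open>\<lambda>\<^sub>j\<close> is real and non-negative with square root \<open>\<xi>\<^sub>j\<close>.\<close>

definition haagerup_vector :: "complex^'n^'m \<Rightarrow> real^'n \<Rightarrow> bool" where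
  "haagerup_vector X \<xi> \<longleftrightarrow>
     (\<exists>u. (\<forall>j. cmod (u $ j) = 1) \<and>
          norm ((X ** diag_mat u) *v 1) = F_norm X \<and>
          (\<forall>j. 0 \<le> \<xi> $ j \<and> haagerup_lambda X u $ j = complex_of_real ((\<xi> $ j)\<^sup>2)))"

end

theory Submission
  imports Defs
begin

text \<open>Write \<open>N(X) = (\<Sum>\<^sub>i \<parallel>\<^sub>iX\<parallel>\<^sub>1\<^sup>2)\<^sup>1\<^sup>/\<^sup>2\<close>. For every complex matrix \<open>\<parallel>X \<Omega>\<parallel>\<^sub>2 \<le> \<parallel>X\<parallel>\<^sub>F \<le> \<parallel>X\<parallel>\<^sub>c\<^sub>b\<^sub>F \<le> N(X)\<close>:
  for the last inequality, apply the \<open>k \<times> k\<close> matrices \<open>a\<^sub>j\<close> to a unit vector \<open>v\<close> and use the triangle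
  inequality in \<open>\<ell>\<^sup>2\<close> row by row on \<open>\<Sum>\<^sub>j X\<^sub>i\<^sub>j a\<^sub>j v\<close> (lemma \<open>cbF_norm_le_row_sum_norm\<close>). If the entries
  are non-negative then \<open>\<parallel>X \<Omega>\<parallel>\<^sub>2 = N(X)\<close>, so all four numbers agree.

  The statement about vectors, for \<open>X \<noteq> 0\<close>, rests on a first-order condition: if \<open>\<parallel>f x\<parallel> \<le> C \<parallel>x\<parallel>\<close> for all \<open>x\<close>, with
  equality at \<open>w\<close>, then \<open>\<langle>f w, f y\<rangle> = C\<^sup>2 \<langle>w, y\<rangle>\<close> for all \<open>y\<close>. Suppose \<open>X = B \<Delta>(\<eta>)\<close> with \<open>\<eta>\<close> a unit vector
  and \<open>\<parallel>B\<parallel> \<le> \<parallel>X\<parallel>\<^sub>F\<close>, and let \<open>u\<close> be unimodular with \<open>\<parallel>X u\<parallel>\<^sub>2 = \<parallel>X\<parallel>\<^sub>F\<close>. Then \<open>B\<close> attains its norm at the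
  unit vector \<open>\<Delta>(\<eta>) u\<close>, and the condition in the direction \<open>u\<^sub>j \<eta>\<^sub>j e\<^sub>j\<close> says exactly that the real part
  of \<open>\<lambda>\<^sub>j\<close> is \<open>\<eta>\<^sub>j\<^sup>2\<close> (lemma \<open>Re_haagerup_lambda_eq\<close>). Hence every Haagerup vector equals every optimal
  positive unit vector, and it remains to see that both exist. With \<open>u = \<Omega>\<close> the numbers \<open>\<lambda>\<^sub>j\<close> are
  non-negative, and division of the columns of \<open>X\<close> by \<open>\<xi>\<^sub>j = \<surd>\<lambda>\<^sub>j\<close> gives \<open>B\<close>, whose norm a weighted
  Cauchy-Schwarz inequality bounds by \<open>N(X)\<close>.\<close>

section \<open>Operator norms of finite arrays\<close>

lemma bdd_above_index_opnorm:
  assumes "finite S"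
  shows "bdd_above ((\<lambda>v. L2_set (\<lambda>r. cmod (\<Sum>s\<in>S. a r s * v s)) R) `
           {v. L2_set (\<lambda>s. cmod (v s)) S \<le> 1})"
proof (rule bdd_aboveI2)
  fix v :: "'a \<Rightarrow> complex"
  assume "v \<in> {v. L2_set (\<lambda>s. cmod (v s)) S \<le> 1}"
  then have v: "cmod (v s) \<le> 1" if "s \<in> S" for s
    using member_le_L2_set[OF assms that, of "\<lambda>s. cmod (v s)"] by simp
  show "L2_set (\<lambda>r. cmod (\<Sum>s\<in>S. a r s * v s)) R \<le> L2_set (\<lambda>r. \<Sum>s\<in>S. cmod (a r s)) R"
  proof (rule L2_set_mono)
    fix r
    show "cmod (\<Sum>s\<in>S. a r s * v s) \<le> (\<Sum>s\<in>S. cmod (a r s))"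
      by (rule sum_norm_le) (simp add: norm_mult v mult_left_le)
  qed simp
qed

lemma index_opnorm_upper:
  assumes "finite S" and "L2_set (\<lambda>s. cmod (v s)) S \<le> 1"
  shows "L2_set (\<lambda>r. cmod (\<Sum>s\<in>S. a r s * v s)) R \<le> index_opnorm R S a"
  unfolding index_opnorm_def
  by (rule cSUP_upper[OF _ bdd_above_index_opnorm]) (use assms in auto)

lemma index_opnorm_least:
  assumes "\<And>v. L2_set (\<lambda>s. cmod (v s)) S \<le> 1 \<Longrightarrow>
             L2_set (\<lambda>r. cmod (\<Sum>s\<in>S. a r s * v s)) R \<le> C"
  shows "index_opnorm R S a \<le> C"
  unfolding index_opnorm_def
proof (rule cSUP_least)
  have "(\<lambda>s. 0) \<in> {v :: _ \<Rightarrow> complex. L2_set (\<lambda>s. cmod (v s)) S \<le> 1}"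
    by (simp add: L2_set_def)
  then show "{v :: _ \<Rightarrow> complex. L2_set (\<lambda>s. cmod (v s)) S \<le> 1} \<noteq> {}"
    by (metis empty_iff)
qed (simp add: assms)

lemma L2_set_cmod_sum_le:
  "L2_set (\<lambda>r. cmod (\<Sum>j\<in>J. f j r)) R \<le> (\<Sum>j\<in>J. L2_set (\<lambda>r. cmod (f j r)) R)"
proof (induction J rule: infinite_finite_induct)
  case (insert j J)
  have "L2_set (\<lambda>r. cmod (\<Sum>j\<in>insert j J. f j r)) R
      \<le> L2_set (\<lambda>r. cmod (f j r) + cmod (\<Sum>j\<in>J. f j r)) R"
    by (rule L2_set_mono) (use insert in \<open>auto intro: norm_triangle_ineq\<close>)
  also have "\<dots> \<le> L2_set (\<lambda>r. cmod (f j r)) R + L2_set (\<lambda>r. cmod (\<Sum>j\<in>J. f j r)) R"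
    by (rule L2_set_triangle_ineq)
  finally show ?case
    using insert by simp
qed (simp_all add: L2_set_0')

lemma max_norm_le_iff: "max_norm z \<le> C \<longleftrightarrow> (\<forall>j. cmod (z $ j) \<le> C)"
  unfolding max_norm_def by (subst Max_le_iff) auto

lemma abelian_matrix_norm_le_iff:
  fixes a :: "nat \<Rightarrow> nat \<Rightarrow> complex^'n"
  shows "abelian_matrix_norm k a \<le> C \<longleftrightarrow>
           (\<forall>j. index_opnorm {..<k} {..<k} (\<lambda>r s. a r s $ j) \<le> C)"
  unfolding abelian_matrix_norm_def by (subst Max_le_iff) auto

section \<open>Comparison of the two norms with the row sums\<close>

text \<open>The number \<open>(\<Sum>\<^sub>i \<parallel>\<^sub>iX\<parallel>\<^sub>1\<^sup>2)\<^sup>1\<^sup>/\<^sup>2\<close>.\<close>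

definition row_sum_norm :: "complex^'n^'m \<Rightarrow> real" where
  "row_sum_norm X = L2_set (\<lambda>i. \<Sum>j\<in>UNIV. cmod (X $ i $ j)) UNIV"

lemma column_matrix_norm_le_row_sum_norm:
  fixes X :: "complex^'n^'m"
  assumes "abelian_matrix_norm k a \<le> 1"
  shows "column_matrix_norm k (\<lambda>r s. X *v a r s) \<le> row_sum_norm X"
  unfolding column_matrix_norm_def
proof (rule index_opnorm_least)
  fix v :: "nat \<Rightarrow> complex"
  assume v: "L2_set (\<lambda>s. cmod (v s)) {..<k} \<le> 1"
  define w where "w j r = (\<Sum>s<k. a r s $ j * v s)" for j r
  have w: "L2_set (\<lambda>r. cmod (w j r)) {..<k} \<le> 1" for j
    using index_opnorm_upper[OF _ v, of "\<lambda>r s. a r s $ j" "{..<k}"] assms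
    unfolding abelian_matrix_norm_le_iff w_def by (meson finite_lessThan order_trans)
  have row: "L2_set (\<lambda>r. cmod (\<Sum>j\<in>UNIV. X $ i $ j * w j r)) {..<k}
      \<le> (\<Sum>j\<in>UNIV. cmod (X $ i $ j))" for i
  proof -
    have "L2_set (\<lambda>r. cmod (X $ i $ j * w j r)) {..<k} \<le> cmod (X $ i $ j)" for j
      using w[of j] by (simp add: norm_mult L2_set_right_distrib[symmetric] mult_left_le)
    then show ?thesis
      by (intro order_trans[OF L2_set_cmod_sum_le] sum_mono)
  qed
  have "(\<Sum>s<k. (case (i, r) of (i, r) \<Rightarrow> \<lambda>s. (X *v a r s) $ i) s * v s)
      = (\<Sum>j\<in>UNIV. X $ i $ j * w j r)" for i r
    by (simp add: matrix_vector_mult_def w_def sum_distrib_left sum_distrib_right mult.assoc)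
      (rule sum.swap)
  then have "L2_set (\<lambda>p. cmod (\<Sum>s<k. (case p of (i, r) \<Rightarrow> \<lambda>s. (X *v a r s) $ i) s * v s))
        (UNIV \<times> {..<k})
      = L2_set (\<lambda>(i, r). cmod (\<Sum>j\<in>UNIV. X $ i $ j * w j r)) (UNIV \<times> {..<k})"
    by (intro L2_set_cong) auto
  also have "\<dots> = L2_set (\<lambda>i. L2_set (\<lambda>r. cmod (\<Sum>j\<in>UNIV. X $ i $ j * w j r)) {..<k}) UNIV"
    by (simp add: L2_set_def sum.cartesian_product sum_nonneg case_prod_unfold)
  also have "\<dots> \<le> row_sum_norm X"
    unfolding row_sum_norm_def by (intro L2_set_mono row) simp
  finally show "L2_set (\<lambda>p. cmod (\<Sum>s<k. (case p of (i, r) \<Rightarrow> \<lambda>s. (X *v a r s) $ i) s * v s))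
      (UNIV \<times> {..<k}) \<le> row_sum_norm X" .
qed

lemma lessThan_nat_one: "{..<Suc 0} = {0}"
  by auto

lemma abelian_matrix_norm_one_le:
  assumes "max_norm z \<le> 1"
  shows "abelian_matrix_norm 1 (\<lambda>r s. z) \<le> 1"
  unfolding abelian_matrix_norm_le_iff
proof (intro allI index_opnorm_least)
  fix j and v :: "nat \<Rightarrow> complex"
  assume "L2_set (\<lambda>s. cmod (v s)) {..<1} \<le> 1"
  moreover have "cmod (z $ j) \<le> 1"
    using assms by (simp add: max_norm_le_iff)
  ultimately show "L2_set (\<lambda>r. cmod (\<Sum>s<1. z $ j * v s)) {..<1::nat} \<le> 1"
    by (simp add: L2_set_def norm_mult mult_le_one power_le_one lessThan_nat_one)
qed

lemma norm_le_column_matrix_norm_one: "norm z \<le> column_matrix_norm 1 (\<lambda>r s. z)"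
proof -
  have "(\<Sum>p\<in>UNIV \<times> {0::nat}. (cmod (z $ fst p))\<^sup>2) = (\<Sum>i\<in>UNIV. (cmod (z $ i))\<^sup>2)"
    using sum.cartesian_product[of "\<lambda>i r. (cmod (z $ i))\<^sup>2" "{0::nat}" UNIV]
    by (simp add: case_prod_unfold)
  then have "norm z = L2_set (\<lambda>p. cmod (\<Sum>s<1::nat. (case p of (i, r) \<Rightarrow> \<lambda>s. z $ i) s * 1))
          (UNIV \<times> {..<1::nat})"
    by (simp add: norm_vec_def L2_set_def case_prod_unfold lessThan_nat_one)
  also have "\<dots> \<le> column_matrix_norm 1 (\<lambda>r s. z)"
    unfolding column_matrix_norm_def by (rule index_opnorm_upper) (simp_all add: L2_set_def)
  finally show ?thesis .
qed

lemma column_matrix_norm_le_cbF_norm: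
  fixes X :: "complex^'n^'m"
  assumes "abelian_matrix_norm k a \<le> 1"
  shows "column_matrix_norm k (\<lambda>r s. X *v a r s) \<le> cbF_norm X"
proof -
  have "bdd_above ((\<lambda>(k, a). column_matrix_norm k (\<lambda>r s. X *v a r s)) `
          {(k, a). abelian_matrix_norm k a \<le> 1})"
    by (rule bdd_aboveI2[where M = "row_sum_norm X"])
      (auto intro: column_matrix_norm_le_row_sum_norm)
  from cSUP_upper[OF _ this, of "(k, a)"] show ?thesis
    using assms by (simp add: cbF_norm_def)
qed

lemma norm_le_cbF_norm: "max_norm z \<le> 1 \<Longrightarrow> norm (X *v z) \<le> cbF_norm X"
  using norm_le_column_matrix_norm_one[of "X *v z"]
    column_matrix_norm_le_cbF_norm[OF abelian_matrix_norm_one_le, of z X]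
  by linarith

lemma norm_le_F_norm:
  fixes X :: "complex^'n^'m"
  assumes "max_norm z \<le> 1"
  shows "norm (X *v z) \<le> F_norm X"
  unfolding F_norm_def
proof (rule cSUP_upper)
  show "bdd_above ((\<lambda>z. norm (X *v z)) ` {z. max_norm z \<le> 1})"
    by (rule bdd_aboveI2[where M = "cbF_norm X"]) (auto intro: norm_le_cbF_norm)
qed (use assms in simp)

lemma F_norm_le_cbF_norm:
  fixes X :: "complex^'n^'m"
  shows "F_norm X \<le> cbF_norm X"
  unfolding F_norm_def
proof (rule cSUP_least)
  have "0 \<in> {z :: complex^'n. max_norm z \<le> 1}"
    by (simp add: max_norm_le_iff)
  then show "{z :: complex^'n. max_norm z \<le> 1} \<noteq> {}"
    by (metis empty_iff)
qed (auto intro: norm_le_cbF_norm)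

lemma cbF_norm_le_row_sum_norm:
  fixes X :: "complex^'n^'m"
  shows "cbF_norm X \<le> row_sum_norm X"
  unfolding cbF_norm_def
proof (rule cSUP_least)
  have "(1, \<lambda>r s. 0) \<in> {(k, a :: nat \<Rightarrow> nat \<Rightarrow> complex^'n). abelian_matrix_norm k a \<le> 1}"
    using abelian_matrix_norm_one_le[of "0 :: complex^'n"] by (simp add: max_norm_le_iff)
  then show "{(k, a :: nat \<Rightarrow> nat \<Rightarrow> complex^'n). abelian_matrix_norm k a \<le> 1} \<noteq> {}"
    by (metis empty_iff)
qed (auto intro: column_matrix_norm_le_row_sum_norm)

section \<open>Haagerup's vector and optimal factorizations\<close>

text \<open>The function \<open>t \<mapsto> C\<^sup>2 \<parallel>w + t y\<parallel>\<^sup>2 - \<parallel>f (w + t y)\<parallel>\<^sup>2\<close> is a non-negative quadratic polynomial that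
  vanishes at \<open>0\<close>, so its linear coefficient is zero.\<close>

lemma inner_eq_if_norm_attained:
  fixes f :: "'a::real_inner \<Rightarrow> 'b::real_inner"
  assumes f: "linear f" and bound: "\<And>x. norm (f x) \<le> C * norm x"
    and attained: "norm (f w) = C * norm w"
  shows "f w \<bullet> f y = C\<^sup>2 * (w \<bullet> y)"
proof -
  define \<alpha> where "\<alpha> = C\<^sup>2 * (w \<bullet> y) - f w \<bullet> f y"
  define \<beta> where "\<beta> = C\<^sup>2 * (y \<bullet> y) - f y \<bullet> f y"
  have sq: "f x \<bullet> f x \<le> C\<^sup>2 * (x \<bullet> x)" for x
    using power_mono[OF bound[of x], of 2] by (simp add: power_mult_distrib power2_norm_eq_inner)
  have w: "f w \<bullet> f w = C\<^sup>2 * (w \<bullet> w)"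
    using arg_cong[OF attained, of "\<lambda>t. t\<^sup>2"] by (simp add: power_mult_distrib power2_norm_eq_inner)
  have quad: "0 \<le> 2 * t * \<alpha> + t\<^sup>2 * \<beta>" for t
    using sq[of "w + t *\<^sub>R y"] w f
    by (simp add: \<alpha>_def \<beta>_def linear_add linear_scale inner_add inner_commute
        algebra_simps power2_eq_square)
  have \<beta>: "0 \<le> \<beta>"
    using sq[of y] by (simp add: \<beta>_def)
  \<comment> \<open>At \<open>t = - s \<alpha>\<close> the linear term dominates as long as \<open>s \<beta> < 2\<close>.\<close>
  define s where "s = 1 / (\<beta> + 1)"
  have s: "0 < s" "s * \<beta> < 2"
    using \<beta> by (simp_all add: s_def divide_simps)
  have "2 * (- s * \<alpha>) * \<alpha> + (- s * \<alpha>)\<^sup>2 * \<beta> = - (s * (2 - s * \<beta>)) * \<alpha>\<^sup>2"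
    by algebra
  then have "0 \<le> - (s * (2 - s * \<beta>)) * \<alpha>\<^sup>2"
    using quad[of "- s * \<alpha>"] by (simp only:)
  moreover have "0 < s * (2 - s * \<beta>)"
    using s by (intro mult_pos_pos) simp_all
  ultimately have "\<alpha>\<^sup>2 \<le> 0"
    by (simp only: zero_le_mult_iff neg_0_le_iff_le neg_le_0_iff_le not_le[symmetric] simp_thms)
  then have "\<alpha> = 0"
    by simp
  then show ?thesis
    by (simp add: \<alpha>_def)
qed

lemma diag_mat_mult_vec: "(diag_mat v *v z) $ j = v $ j * z $ j"
  by (simp add: diag_mat_def matrix_vector_mult_def if_distrib[of "\<lambda>c. c * _"] cong: if_cong)

lemma norm_diag_mat_unimodular:
  assumes "\<And>j. cmod (u $ j) = 1"
  shows "norm (diag_mat (complex_vec \<xi>) *v u) = norm \<xi>"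
  by (simp add: norm_vec_def diag_mat_mult_vec complex_vec_def norm_mult assms)

lemma haagerup_lambda_nth:
  "haagerup_lambda X u $ j =
     (cnj (u $ j) * (\<Sum>i\<in>UNIV. cnj (X $ i $ j) * (X *v u) $ i)) / (F_norm X)\<^sup>2"
proof -
  have 1: "diag_mat u *v 1 = u"
    by (simp add: vec_eq_iff diag_mat_mult_vec)
  have 2: "conj_transpose (diag_mat u) = diag_mat (\<chi> j. cnj (u $ j))"
    by (simp add: vec_eq_iff conj_transpose_def diag_mat_def)
  show ?thesis
    unfolding haagerup_lambda_def matrix_vector_mul_assoc[symmetric] 1 2
    by (simp add: diag_mat_mult_vec)
      (simp add: matrix_vector_mult_def conj_transpose_def scaleR_conv_of_real divide_inverse)
qed

text \<open>The real inner product on \<^typ>\<open>complex^'m\<close> is the real part of the Hermitian one.\<close>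

lemma Re_haagerup_lambda:
  "Re (haagerup_lambda X u $ j) = ((X *v u) \<bullet> (X *v axis j (u $ j))) / (F_norm X)\<^sup>2"
proof -
  have "(X *v axis j (u $ j)) $ i = X $ i $ j * u $ j" for i
    by (simp add: matrix_vector_mult_def axis_def if_distrib[of "\<lambda>c. _ * c"] cong: if_cong)
  then have "(X *v u) \<bullet> (X *v axis j (u $ j))
      = (\<Sum>i\<in>UNIV. Re (cnj (u $ j) * (cnj (X $ i $ j) * (X *v u) $ i)))"
    unfolding inner_vec_def inner_complex_def
    by (intro sum.cong) (simp_all add: algebra_simps)
  also have "\<dots> = Re (cnj (u $ j) * (\<Sum>i\<in>UNIV. cnj (X $ i $ j) * (X *v u) $ i))"
    by (simp only: sum_distrib_left Re_sum)
  finally show ?thesis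
    unfolding haagerup_lambda_nth of_real_power[symmetric] Re_divide_of_real by simp
qed

text \<open>No choice of \<open>u\<close> and no factorization is distinguished here: any admissible \<open>u\<close> is linked to any
  unit vector \<open>\<eta>\<close> that gives a factorization with \<open>\<parallel>B\<parallel> \<le> \<parallel>X\<parallel>\<^sub>F\<close>.\<close>

lemma Re_haagerup_lambda_eq:
  fixes X B :: "complex^'n^'m"
  assumes X: "X = B ** diag_mat (complex_vec \<eta>)" and \<eta>: "norm \<eta> = 1"
    and B: "mat_opnorm B \<le> F_norm X" and pos: "F_norm X > 0"
    and u: "\<And>j. cmod (u $ j) = 1" and attained: "norm (X *v u) = F_norm X"
  shows "Re (haagerup_lambda X u $ j) = (\<eta> $ j)\<^sup>2"
proof -
  define w where "w = diag_mat (complex_vec \<eta>) *v u"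
  define y where "y = diag_mat (complex_vec \<eta>) *v axis j (u $ j)"
  have bw: "B *v w = X *v u" and By: "B *v y = X *v axis j (u $ j)"
    by (simp_all add: X w_def y_def matrix_vector_mul_assoc)
  have "norm (B *v x) \<le> F_norm X * norm x" for x
    using onorm[OF matrix_vector_mul_bounded_linear, of B x] mult_right_mono[OF B norm_ge_zero[of x]]
    by (simp add: mat_opnorm_def)
  moreover have "norm w = 1"
    unfolding w_def using norm_diag_mat_unimodular[OF u] \<eta> by simp
  then have "norm (B *v w) = F_norm X * norm w"
    by (simp add: bw attained)
  ultimately have "(B *v w) \<bullet> (B *v y) = (F_norm X)\<^sup>2 * (w \<bullet> y)"
    by (intro inner_eq_if_norm_attained bounded_linear.linear[OF matrix_vector_mul_bounded_linear])
  moreover have "w \<bullet> y = (\<eta> $ j)\<^sup>2"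
  proof -
    have "y = axis j (w $ j)"
      by (simp add: vec_eq_iff y_def w_def diag_mat_mult_vec axis_def)
    then have "w \<bullet> y = (norm (w $ j))\<^sup>2"
      by (simp add: inner_axis power2_norm_eq_inner)
    then show ?thesis
      by (simp add: w_def diag_mat_mult_vec complex_vec_def norm_mult u)
  qed
  ultimately show ?thesis
    using pos by (simp add: Re_haagerup_lambda bw By)
qed

lemma haagerup_vector_unique:
  fixes X :: "complex^'n^'m"
  assumes eq: "cbF_norm X = F_norm X" and pos: "F_norm X > 0"
    and \<xi>: "haagerup_vector X \<xi>" and \<eta>: "optimal_positive_unit_vector X \<eta>"
  shows "\<eta> = \<xi>"
proof -
  obtain B where B: "X = B ** diag_mat (complex_vec \<eta>)" "\<And>j. 0 \<le> \<eta> $ j" "norm \<eta> = 1"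
      "mat_opnorm B = cbF_norm X"
    using \<eta> by (auto simp: optimal_positive_unit_vector_def cbF_factorization_def)
  obtain u where u: "\<And>j. cmod (u $ j) = 1" "norm ((X ** diag_mat u) *v 1) = F_norm X"
      "\<And>j. 0 \<le> \<xi> $ j" "\<And>j. haagerup_lambda X u $ j = complex_of_real ((\<xi> $ j)\<^sup>2)"
    using \<xi> unfolding haagerup_vector_def by blast
  have "diag_mat u *v 1 = u"
    by (simp add: vec_eq_iff diag_mat_mult_vec)
  with u(2) have "norm (X *v u) = F_norm X"
    by (simp add: matrix_vector_mul_assoc[symmetric])
  then have "(\<eta> $ j)\<^sup>2 = (\<xi> $ j)\<^sup>2" for j
    using Re_haagerup_lambda_eq[OF B(1,3) _ pos u(1), of j] B(4) eq u(4)[of j] by simp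
  then show ?thesis
    using B(2) u(3) by (simp add: vec_eq_iff power2_eq_iff_nonneg)
qed

section \<open>Non-negative matrices\<close>

text \<open>A form of the Schur test: if \<open>X\<close> has non-negative entries and row sums \<open>r\<close>, and the weights \<open>\<xi>\<close>
  satisfy \<open>X\<^sup>T r = C\<^sup>2 \<xi>\<^sup>2\<close> (entrywise square), then division of the columns by the weights gives an
  operator of norm at most \<open>C\<close>. A column of weight zero becomes zero, by the convention \<open>x / 0 = 0\<close>.\<close>

lemma norm_column_scaled_le:
  fixes X :: "real^'n^'m" and z :: "complex^'n"
  defines "r \<equiv> \<lambda>i. \<Sum>j\<in>UNIV. X $ i $ j"
  assumes nonneg: "\<And>i j. 0 \<le> X $ i $ j" and C: "0 \<le> C"
    and \<xi>: "\<And>j. (\<Sum>i\<in>UNIV. X $ i $ j * r i) = C\<^sup>2 * (\<xi> $ j)\<^sup>2"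
  shows "norm ((\<chi> i j. complex_of_real (X $ i $ j / \<xi> $ j)) *v z) \<le> C * norm z"
proof (rule power2_le_imp_le)
  let ?q = "\<lambda>j. cmod (z $ j) / \<bar>\<xi> $ j\<bar>"
  have "(cmod (\<Sum>j\<in>UNIV. complex_of_real (X $ i $ j / \<xi> $ j) * z $ j))\<^sup>2
      \<le> r i * (\<Sum>j\<in>UNIV. X $ i $ j * (?q j)\<^sup>2)" for i
  proof -
    have "cmod (\<Sum>j\<in>UNIV. complex_of_real (X $ i $ j / \<xi> $ j) * z $ j)
        \<le> (\<Sum>j\<in>UNIV. sqrt (X $ i $ j) * (sqrt (X $ i $ j) * ?q j))"
      by (rule sum_norm_le)
        (simp add: norm_mult norm_divide nonneg mult.assoc[symmetric])
    then have "(cmod (\<Sum>j\<in>UNIV. complex_of_real (X $ i $ j / \<xi> $ j) * z $ j))\<^sup>2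
        \<le> (\<Sum>j\<in>UNIV. sqrt (X $ i $ j) * (sqrt (X $ i $ j) * ?q j))\<^sup>2"
      by (rule power_mono) simp
    also have "\<dots> \<le> (\<Sum>j\<in>UNIV. (sqrt (X $ i $ j))\<^sup>2) * (\<Sum>j\<in>UNIV. (sqrt (X $ i $ j) * ?q j)\<^sup>2)"
      by (rule Cauchy_Schwarz_ineq_sum)
    also have "\<dots> = r i * (\<Sum>j\<in>UNIV. X $ i $ j * (?q j)\<^sup>2)"
      by (simp add: r_def nonneg power_mult_distrib power_divide)
    finally show ?thesis .
  qed
  then have "(norm ((\<chi> i j. complex_of_real (X $ i $ j / \<xi> $ j)) *v z))\<^sup>2
      \<le> (\<Sum>i\<in>UNIV. r i * (\<Sum>j\<in>UNIV. X $ i $ j * (?q j)\<^sup>2))"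
    by (simp add: norm_vec_def L2_set_def sum_nonneg matrix_vector_mult_def sum_mono
        del: of_real_divide)
  also have "\<dots> = (\<Sum>j\<in>UNIV. (\<Sum>i\<in>UNIV. X $ i $ j * r i) * (?q j)\<^sup>2)"
    unfolding sum_distrib_left sum_distrib_right
    by (subst sum.swap) (simp add: ac_simps)
  also have "\<dots> \<le> (\<Sum>j\<in>UNIV. C\<^sup>2 * (cmod (z $ j))\<^sup>2)"
    by (rule sum_mono) (simp add: \<xi> power_divide)
  also have "\<dots> = (C * norm z)\<^sup>2"
    by (simp add: norm_vec_def L2_set_def sum_nonneg power_mult_distrib sum_distrib_left)
  finally show "(norm ((\<chi> i j. complex_of_real (X $ i $ j / \<xi> $ j)) *v z))\<^sup>2 \<le> (C * norm z)\<^sup>2" .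
qed (simp add: C)

lemma map_matrix_of_real_mult_one:
  "(map_matrix complex_of_real X *v 1) $ i = complex_of_real (\<Sum>j\<in>UNIV. X $ i $ j)"
  by (simp add: matrix_vector_mult_def map_matrix_def)

lemma nonneg_matrix_norms:
  fixes X :: "real^'n^'m"
  defines "XC \<equiv> map_matrix complex_of_real X"
  assumes nonneg: "\<And>i j. 0 \<le> X $ i $ j"
  shows "F_norm XC = row_sum_norm XC" and "cbF_norm XC = row_sum_norm XC"
    and "norm (XC *v 1) = row_sum_norm XC"
proof -
  show one: "norm (XC *v 1) = row_sum_norm XC"
    unfolding norm_vec_def row_sum_norm_def XC_def map_matrix_of_real_mult_one
    by (simp add: map_matrix_def nonneg sum_nonneg del: of_real_sum)
  have "norm (XC *v 1) \<le> F_norm XC"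
    by (rule norm_le_F_norm) (simp add: max_norm_le_iff)
  then show "F_norm XC = row_sum_norm XC" "cbF_norm XC = row_sum_norm XC"
    using one F_norm_le_cbF_norm[of XC] cbF_norm_le_row_sum_norm[of XC] by linarith+
qed

text \<open>The choice \<open>u = \<Omega>\<close> gives \<open>\<lambda> = \<parallel>X\<parallel>\<^sub>F\<^sup>-\<^sup>2 X\<^sup>T r\<close> with \<open>r\<close> the vector of row sums, and its entrywise square
  root is both a Haagerup vector and optimal.\<close>

lemma nonneg_matrix_haagerup_exists:
  fixes X :: "real^'n^'m"
  defines "XC \<equiv> map_matrix complex_of_real X"
  assumes nonneg: "\<And>i j. 0 \<le> X $ i $ j" and pos: "F_norm XC > 0"
  shows "\<exists>\<xi>. haagerup_vector XC \<xi> \<and> optimal_positive_unit_vector XC \<xi>"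
proof -
  define C where "C = F_norm XC"
  define r where "r i = (\<Sum>j\<in>UNIV. X $ i $ j)" for i
  define \<xi> where "\<xi> = (\<chi> j. sqrt ((\<Sum>i\<in>UNIV. X $ i $ j * r i) / C\<^sup>2))"
  define B where "B = (\<chi> i j. complex_of_real (X $ i $ j / \<xi> $ j))"
  have C: "C > 0" "norm (XC *v 1) = C" "cbF_norm XC = C"
    using pos nonneg_matrix_norms[of X] nonneg by (simp_all add: C_def XC_def)
  have r: "0 \<le> r i" for i
    by (simp add: r_def nonneg sum_nonneg)
  have XC1: "(XC *v 1) $ i = complex_of_real (r i)" for i
    by (simp only: XC_def map_matrix_of_real_mult_one r_def)
  have \<xi>0: "0 \<le> \<xi> $ j" for j
    by (simp add: \<xi>_def nonneg r sum_nonneg)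
  have \<xi>2: "(\<xi> $ j)\<^sup>2 = (\<Sum>i\<in>UNIV. X $ i $ j * r i) / C\<^sup>2" for j
    by (simp add: \<xi>_def nonneg r sum_nonneg)
  have "haagerup_lambda XC 1 $ j = complex_of_real ((\<xi> $ j)\<^sup>2)" for j
    unfolding haagerup_lambda_nth XC1 \<xi>2 C_def[symmetric] by (simp add: XC_def map_matrix_def)
  moreover have "diag_mat 1 *v 1 = (1 :: complex^'n)"
    by (simp add: vec_eq_iff diag_mat_mult_vec)
  ultimately have H: "haagerup_vector XC \<xi>"
    unfolding haagerup_vector_def
    by (intro exI[of _ 1]) (simp add: \<xi>0 C(2) C_def matrix_vector_mul_assoc[symmetric])
  have norm_\<xi>: "norm \<xi> = 1"
  proof -
    have "C\<^sup>2 = (\<Sum>i\<in>UNIV. (r i)\<^sup>2)"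
      unfolding C(2)[symmetric] by (simp add: norm_vec_def XC1 L2_set_def sum_nonneg)
    also have "\<dots> = (\<Sum>i\<in>UNIV. \<Sum>j\<in>UNIV. X $ i $ j * r i)"
      by (simp add: power2_eq_square r_def sum_distrib_right)
    also have "\<dots> = C\<^sup>2 * (\<Sum>j\<in>UNIV. (\<xi> $ j)\<^sup>2)"
    proof -
      have "C\<^sup>2 * (\<xi> $ j)\<^sup>2 = (\<Sum>i\<in>UNIV. X $ i $ j * r i)" for j
        using C(1) by (simp add: \<xi>2)
      then show ?thesis
        unfolding sum_distrib_left by (simp only:) (rule sum.swap)
    qed
    finally show ?thesis
      using C(1) by (simp add: norm_vec_def L2_set_def)
  qed
  \<comment> \<open>If \<open>\<xi>\<^sub>j = 0\<close> then \<open>X\<^sub>i\<^sub>j r\<^sub>i = 0\<close> for all \<open>i\<close>, and \<open>X\<^sub>i\<^sub>j \<le> r\<^sub>i\<close> makes the whole column zero.\<close>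
  have zero: "X $ i $ j = 0" if "\<xi> $ j = 0" for i j
  proof -
    have "(\<Sum>i\<in>UNIV. X $ i $ j * r i) = 0"
      using \<xi>2[of j] that C(1) by simp
    then have "X $ i $ j * r i = 0"
      by (subst (asm) sum_nonneg_eq_0_iff) (simp_all add: nonneg r)
    moreover have "X $ i $ j \<le> r i"
      unfolding r_def by (rule member_le_sum) (simp_all add: nonneg)
    ultimately show ?thesis
      using nonneg[of i j] by auto
  qed
  have fact: "XC = B ** diag_mat (complex_vec \<xi>)"
    using zero
    by (auto simp: vec_eq_iff matrix_matrix_mult_def diag_mat_def B_def XC_def map_matrix_def
        complex_vec_def if_distrib[of "\<lambda>c. _ * c"] cong: if_cong)
  have "(\<Sum>i\<in>UNIV. X $ i $ j * (\<Sum>j\<in>UNIV. X $ i $ j)) = C\<^sup>2 * (\<xi> $ j)\<^sup>2" for j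
    using C(1) \<xi>2[of j] by (simp add: r_def)
  then have "norm (B *v z) \<le> C * norm z" for z
    unfolding B_def using C(1) nonneg by (intro norm_column_scaled_le) auto
  then have "mat_opnorm B \<le> C"
    unfolding mat_opnorm_def by (rule onorm_le)
  moreover have "C \<le> mat_opnorm B"
  proof -
    have "C = norm (B *v (diag_mat (complex_vec \<xi>) *v 1))"
      using C(2) by (simp add: fact matrix_vector_mul_assoc)
    also have "\<dots> \<le> mat_opnorm B * norm (diag_mat (complex_vec \<xi>) *v 1)"
      unfolding mat_opnorm_def by (rule onorm) simp
    finally show ?thesis
      by (simp add: norm_diag_mat_unimodular norm_\<xi>)
  qed
  ultimately have "cbF_factorization XC B \<xi>"
    by (simp add: cbF_factorization_def fact[symmetric] \<xi>0 norm_\<xi> C(3))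
  with H show ?thesis
    by (auto simp: optimal_positive_unit_vector_def)
qed

theorem theorem3p2:
  fixes X :: "real^'n^'m"
  defines "XC \<equiv> map_matrix complex_of_real X"
  assumes nonneg: "\<And>i j. 0 \<le> X $ i $ j"
  shows "cbF_norm XC = F_norm XC \<and>
         F_norm XC = sqrt (\<Sum>i\<in>UNIV. (\<Sum>j\<in>UNIV. \<bar>X $ i $ j\<bar>)\<^sup>2) \<and>
         (X \<noteq> 0 \<longrightarrow>
           (\<exists>\<xi>. haagerup_vector XC \<xi>) \<and>
           (\<forall>\<xi>. haagerup_vector XC \<xi> \<longrightarrow>
              (\<forall>\<eta>. optimal_positive_unit_vector XC \<eta> \<longleftrightarrow> \<eta> = \<xi>)))"
proof (intro conjI impI)
  have row: "row_sum_norm XC = sqrt (\<Sum>i\<in>UNIV. (\<Sum>j\<in>UNIV. \<bar>X $ i $ j\<bar>)\<^sup>2)"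
    by (simp add: row_sum_norm_def L2_set_def XC_def map_matrix_def)
  have F: "F_norm XC = row_sum_norm XC" and cb: "cbF_norm XC = row_sum_norm XC"
    using nonneg_matrix_norms[of X] nonneg by (simp_all add: XC_def)
  show eq: "cbF_norm XC = F_norm XC"
    by (simp add: F cb)
  show "F_norm XC = sqrt (\<Sum>i\<in>UNIV. (\<Sum>j\<in>UNIV. \<bar>X $ i $ j\<bar>)\<^sup>2)"
    by (simp add: F row)
  assume "X \<noteq> 0"
  have "F_norm XC \<noteq> 0"
  proof
    assume "F_norm XC = 0"
    then have "row_sum_norm XC = 0"
      by (simp add: F)
    then have "X $ i $ j = 0" for i j
      by (simp add: row_sum_norm_def XC_def map_matrix_def L2_set_eq_0_iff sum_nonneg_eq_0_iff)
    with \<open>X \<noteq> 0\<close> show False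
      by (simp add: vec_eq_iff)
  qed
  then have pos: "F_norm XC > 0"
    by (simp add: F row_sum_norm_def order.strict_iff_order)
  then obtain \<xi>0 where \<xi>0: "haagerup_vector XC \<xi>0" "optimal_positive_unit_vector XC \<xi>0"
    using nonneg_matrix_haagerup_exists[of X] nonneg by (auto simp: XC_def)
  then show "\<exists>\<xi>. haagerup_vector XC \<xi>"
    by blast
  show "\<forall>\<xi>. haagerup_vector XC \<xi> \<longrightarrow> (\<forall>\<eta>. optimal_positive_unit_vector XC \<eta> \<longleftrightarrow> \<eta> = \<xi>)"
    using haagerup_vector_unique[OF eq pos] \<xi>0(2) by blast
qed

end
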